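(* Let $f:\mathbb{R}^n\to\mathbb{R}$ be $\rho$-strongly convex and $L$-smooth ($\rho,L>0$), let $b\in\mathbb{R}^p$, and let $A\in\mathbb{R}^{p\times n}$ satisfy $a_{\min}I_p\preceq AA^\top\preceq a_{\max}I_p$ with $a_{\min},a_{\max}\in\mathbb{R}_{>0}$. For any $k_p^{eq}\ge0$, $k_i^{eq}>0$ and $k_d^{eq}\ge0$, with $M:=I_n+k_d^{eq}A^\top A$, the flow $$\dot x=-M^{-1}\big(\nabla f(x)+A^\top\nu+k_p^{eq}A^\top(Ax-b)\big),\qquad\dot\nu=k_i^{eq}(Ax-b)$$ on $\mathbb{R}^n\times\mathbb{R}^p$ is strongly infinitesimally contracting with respect to $\|\cdot\|_P$ with rate $c_{eq}>0$, where $$P=\begin{bmatrix}M&\alpha A^\top\\ \alpha A&\frac{1}{k_i^{eq}}I_p\end{bmatrix}\succ0,\qquad \alpha=\frac12\min\Big\{\frac{1}{L+k_p^{eq}a_{\max}},\ \frac{\rho}{k_i^{eq}a_{\max}}\Big\},\qquad c_{eq}=\frac12\,\alpha\,k_i^{eq}\,\frac{a_{\min}}{1+k_d^{eq}a_{\max}}.$$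
   Context: $f$ is $\rho$-strongly convex if $x\mapsto f(x)-\frac\rho2\|x\|_2^2$ is convex, and $L$-smooth if it is differentiable with $L$-Lipschitz gradient. For $P\succ0$, $\|z\|_P=\sqrt{z^\top Pz}$, and the associated logarithmic norm is $\mu_P(S)=\min\{\beta\in\mathbb{R}: PS+S^\top P\preceq2\beta P\}$. A (locally Lipschitz) vector field $F$ is $c$-strongly infinitesimally contracting with respect to $\|\cdot\|_P$, with rate $c>0$, if $\mu_P(J_F(z))\le-c$ for all $z$ at which the Jacobian $J_F(z)$ exists (which is almost every $z$). *)

theory Defs
  imports "HOL-Analysis.Analysis"
begin

definition strongly_convex :: "real \<Rightarrow> (real ^ 'n::finite \<Rightarrow> real) \<Rightarrow> bool" where
  "strongly_convex \<rho> f \<longleftrightarrow> convex_on UNIV (\<lambda>x. f x - \<rho> / 2 * (norm x)\<^sup>2)"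

text \<open>Meaningful only at points where \<open>f\<close> is differentiable.\<close>
definition gradient :: "(real ^ 'n::finite \<Rightarrow> real) \<Rightarrow> real ^ 'n \<Rightarrow> real ^ 'n" where
  "gradient f x = (THE D. GDERIV f x :> D)"

definition L_smooth :: "real \<Rightarrow> (real ^ 'n::finite \<Rightarrow> real) \<Rightarrow> bool" where
  "L_smooth L f \<longleftrightarrow> (\<forall>x. f differentiable (at x)) \<and> L-lipschitz_on UNIV (gradient f)"

definition psd_matrix :: "real ^ 'm ^ 'm::finite \<Rightarrow> bool" where
  "psd_matrix A \<longleftrightarrow> transpose A = A \<and> (\<forall>v. 0 \<le> v \<bullet> (A *v v))"

definition pos_def_matrix :: "real ^ 'm ^ 'm::finite \<Rightarrow> bool" where
  "pos_def_matrix A \<longleftrightarrow> transpose A = A \<and> (\<forall>v. v \<noteq> 0 \<longrightarrow> 0 < v \<bullet> (A *v v))"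

definition loewner_le :: "real ^ 'm ^ 'm::finite \<Rightarrow> real ^ 'm ^ 'm \<Rightarrow> bool"
    (infix "\<preceq>\<^sub>L" 50) where
  "A \<preceq>\<^sub>L B \<longleftrightarrow> psd_matrix (B - A)"

text \<open>For positive definite \<open>P\<close> the minimum exists; otherwise the value is unspecified.\<close>
definition log_norm :: "real ^ 'm ^ 'm::finite \<Rightarrow> real ^ 'm ^ 'm \<Rightarrow> real" where
  "log_norm P S = (LEAST \<beta>. P ** S + transpose S ** P \<preceq>\<^sub>L (2 * \<beta>) *\<^sub>R P)"

text \<open>Strong infinitesimal contraction with respect to the norm
  \<open>z \<mapsto> sqrt (z \<bullet> (P *v z))\<close>, for positive definite \<open>P\<close>. The autonomous field
  \<open>F\<close> is viewed as constant in time to use \<^const>\<open>local_lipschitz\<close>; the Jacobian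
  exists at \<open>z\<close> when \<open>F\<close> is (Frechet) differentiable there.\<close>
definition strongly_inf_contracting ::
    "real ^ 'm ^ 'm::finite \<Rightarrow> real \<Rightarrow> (real ^ 'm \<Rightarrow> real ^ 'm) \<Rightarrow> bool" where
  "strongly_inf_contracting P c F \<longleftrightarrow>
     0 < c \<and>
     local_lipschitz (UNIV :: real set) UNIV (\<lambda>_. F) \<and>
     (\<forall>z. F differentiable (at z) \<longrightarrow> log_norm P (jacobian F (at z)) \<le> - c)"

text \<open>\<open>\<real>\<^sup>n \<times> \<real>\<^sup>p\<close> is represented as the vectors indexed by the sum type
  \<open>'n + 'p\<close>, so that block matrices are ordinary matrices.\<close>
definition block_vec :: "real ^ 'n \<Rightarrow> real ^ 'p \<Rightarrow> real ^ ('n::finite + 'p::finite)" where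
  "block_vec x y = (\<chi> i. case i of Inl j \<Rightarrow> x $ j | Inr j \<Rightarrow> y $ j)"

definition vec_Inl :: "real ^ ('n::finite + 'p::finite) \<Rightarrow> real ^ 'n" where
  "vec_Inl z = (\<chi> i. z $ Inl i)"

definition vec_Inr :: "real ^ ('n::finite + 'p::finite) \<Rightarrow> real ^ 'p" where
  "vec_Inr z = (\<chi> i. z $ Inr i)"

definition block_mat ::
    "real ^ 'n ^ 'n \<Rightarrow> real ^ 'p ^ 'n \<Rightarrow> real ^ 'n ^ 'p \<Rightarrow> real ^ 'p ^ 'p
      \<Rightarrow> real ^ ('n::finite + 'p::finite) ^ ('n + 'p)" where
  "block_mat A B C D = (\<chi> i. case i of
       Inl j \<Rightarrow> block_vec (A $ j) (B $ j)
     | Inr j \<Rightarrow> block_vec (C $ j) (D $ j))"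

text \<open>The flow is \<open>z' = pid_flow f A b kp ki kd z\<close> with \<open>z = (x, \<nu>)\<close>.\<close>
definition pid_flow ::
    "(real ^ 'n \<Rightarrow> real) \<Rightarrow> real ^ 'n ^ 'p \<Rightarrow> real ^ 'p \<Rightarrow> real \<Rightarrow> real \<Rightarrow> real
      \<Rightarrow> real ^ ('n::finite + 'p::finite) \<Rightarrow> real ^ ('n::finite + 'p::finite)" where
  "pid_flow f A b kp ki kd z =
     (let x = vec_Inl z; \<nu> = vec_Inr z; M = mat 1 + kd *\<^sub>R (transpose A ** A)
      in block_vec
           (- (matrix_inv M *v
                (gradient f x + transpose A *v \<nu> + kp *\<^sub>R (transpose A *v (A *v x - b)))))
           (ki *\<^sub>R (A *v x - b)))"

end

theory Submission
  imports Defs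
begin

text \<open>Instead of the Jacobian, all estimates are made for finite increments of the flow \<open>F\<close>:
  the one-sided Lipschitz bound
  \<open>(F z' - F z) \<bullet> (P *v (z' - z)) \<le> - c * ((z' - z) \<bullet> (P *v (z' - z)))\<close>
  passes to the limit at every point of differentiability, and no Hessian of \<open>f\<close> is needed.
  The increment \<open>g\<close> of the gradient of \<open>f\<close> over \<open>u\<close> enters only through strong monotonicity and
  the Baillon--Haddad inequality \<open>(norm g)\<^sup>2 \<le> L * (g \<bullet> u)\<close>.  Decay in \<open>\<nu>\<close> comes from the
  off-diagonal blocks of \<open>P\<close>, which contribute \<open>\<alpha> A M\<^sup>-\<^sup>1 A\<^sup>T\<close>.\<close>

section \<open>Transposes, inner products and scalar multiples of matrices\<close>

lemma inner_transpose_mult: "(transpose A *v y) \<bullet> x = y \<bullet> (A *v x)"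
  for A :: "real ^ 'n ^ 'm"
  by (simp add: dot_lmul_matrix)

lemma inner_symmetric_matrix:
  fixes S :: "real ^ 'n ^ 'n"
  assumes "transpose S = S"
  shows "(S *v x) \<bullet> y = x \<bullet> (S *v y)"
  using inner_transpose_mult[of S x y] assms by simp

lemma transpose_scaleR: "transpose (k *\<^sub>R A) = k *\<^sub>R transpose A"
  for A :: "real ^ 'n ^ 'm"
  by (simp add: transpose_def vec_eq_iff)

lemma transpose_add: "transpose (A + B) = transpose A + transpose B"
  for A B :: "real ^ 'n ^ 'm"
  by (simp add: transpose_def vec_eq_iff)

lemma transpose_diff: "transpose (A - B) = transpose A - transpose B"
  for A B :: "real ^ 'n ^ 'm"
  by (simp add: transpose_def vec_eq_iff)

lemma scaleR_matrix_vector: "(k *\<^sub>R A) *v x = k *\<^sub>R (A *v x)"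
  for A :: "real ^ 'n ^ 'm"
  by (simp add: scaleR_matrix_vector_assoc)

subsection \<open>Block vectors and matrices\<close>

lemma vec_Inl_block_vec [simp]: "vec_Inl (block_vec x y) = x"
  by (simp add: vec_Inl_def block_vec_def vec_eq_iff)

lemma vec_Inr_block_vec [simp]: "vec_Inr (block_vec x y) = y"
  by (simp add: vec_Inr_def block_vec_def vec_eq_iff)

lemma block_vec_collapse [simp]: "block_vec (vec_Inl z) (vec_Inr z) = z"
  by (simp add: vec_Inl_def vec_Inr_def block_vec_def vec_eq_iff split: sum.split)

lemma block_vec_diff: "block_vec x y - block_vec x' y' = block_vec (x - x') (y - y')"
  by (simp add: block_vec_def vec_eq_iff split: sum.split)

lemma block_vec_eq_0_iff [simp]: "block_vec x y = 0 \<longleftrightarrow> x = 0 \<and> y = 0"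
  by (metis block_vec_diff diff_self vec_Inl_block_vec vec_Inr_block_vec)

lemma inner_block_vec: "block_vec x y \<bullet> block_vec x' y' = x \<bullet> x' + y \<bullet> y'"
proof -
  have "block_vec x y \<bullet> block_vec x' y' =
      (\<Sum>i \<in> UNIV <+> UNIV. block_vec x y $ i \<bullet> block_vec x' y' $ i)"
    by (simp only: inner_vec_def UNIV_Plus_UNIV)
  also have "\<dots> = x \<bullet> x' + y \<bullet> y'"
    by (subst sum.Plus) (simp_all add: block_vec_def inner_vec_def)
  finally show ?thesis .
qed

text \<open>Each row of a block matrix is itself a block vector, so every component of the product
  is an instance of \<open>inner_block_vec\<close>.\<close>

lemma block_mat_mult_block_vec:
  "block_mat A B C D *v block_vec x y = block_vec (A *v x + B *v y) (C *v x + D *v y)"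
proof -
  have "block_vec a b' \<bullet> block_vec x y = a \<bullet> x + b' \<bullet> y" for a b'
    by (rule inner_block_vec)
  then show ?thesis
    by (simp add: vec_eq_iff matrix_vector_mul_component block_mat_def block_vec_def[of "_ + _"]
        split: sum.split)
qed

lemma transpose_block_mat:
  "transpose (block_mat A B C D) =
    block_mat (transpose A) (transpose C) (transpose B) (transpose D)"
  by (simp add: transpose_def block_mat_def block_vec_def vec_eq_iff split: sum.split)

lemma linear_vec_Inl: "linear vec_Inl"
  by (rule linearI) (simp_all add: vec_Inl_def vec_eq_iff)

lemma linear_vec_Inr: "linear vec_Inr"
  by (rule linearI) (simp_all add: vec_Inr_def vec_eq_iff)

lemma linear_block_vec_fst: "linear (\<lambda>x. block_vec x 0)"
  by (rule linearI) (simp_all add: block_vec_def vec_eq_iff split: sum.split)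

lemma linear_block_vec_snd: "linear (\<lambda>y. block_vec 0 y)"
  by (rule linearI) (simp_all add: block_vec_def vec_eq_iff split: sum.split)

lemma block_vec_eq_add: "block_vec x y = block_vec x 0 + block_vec 0 y"
  by (simp add: block_vec_def vec_eq_iff split: sum.split)

subsection \<open>Globally Lipschitz maps\<close>

text \<open>Only the existence of a Lipschitz constant matters later. Hiding it behind an
  existential lets this rule and the next two be chained by \<open>intro\<close> without computing
  constants.\<close>

lemma linear_lipschitz:
  fixes T :: "'a::euclidean_space \<Rightarrow> 'b::real_normed_vector"
  assumes "linear T"
  shows "\<exists>C. C-lipschitz_on UNIV T"
  using assms by (meson bounded_linear.lipschitz_boundE linear_conv_bounded_linear)

lemma lipschitz_ex_add:
  fixes F G :: "'a::metric_space \<Rightarrow> 'b::real_normed_vector"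
  assumes "\<exists>C. C-lipschitz_on UNIV F" "\<exists>C. C-lipschitz_on UNIV G"
  shows "\<exists>C. C-lipschitz_on UNIV (\<lambda>x. F x + G x)"
  using assms by (blast intro: lipschitz_on_add)

lemma lipschitz_ex_compose:
  assumes "\<exists>C. C-lipschitz_on UNIV G" "\<exists>C. C-lipschitz_on UNIV F"
  shows "\<exists>C. C-lipschitz_on UNIV (\<lambda>x. G (F x))"
  using assms by (blast intro: lipschitz_on_compose2 lipschitz_on_subset)

subsection \<open>Logarithmic norm\<close>

text \<open>The \<open>LEAST\<close> over the reals has a usable value only once a minimum is
  exhibited. The admissible values are exactly the upper bounds of the generalised Rayleigh quotient
  \<open>R\<close> over nonzero vectors, so the minimum is the supremum of \<open>R\<close>, which
  is at most \<open>\<beta>\<close>.\<close>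

lemma log_norm_le:
  fixes P S :: "real ^ 'm ^ 'm::finite"
  assumes P: "pos_def_matrix P"
    and le: "\<And>h. (S *v h) \<bullet> (P *v h) \<le> \<beta> * (h \<bullet> (P *v h))"
  shows "log_norm P S \<le> \<beta>"
proof -
  have symP: "transpose P = P" and posP: "\<And>v. v \<noteq> 0 \<Longrightarrow> 0 < v \<bullet> (P *v v)"
    using P by (auto simp: pos_def_matrix_def)
  define R where "R h = ((S *v h) \<bullet> (P *v h)) / (h \<bullet> (P *v h))" for h
  have form: "h \<bullet> (((2 * t) *\<^sub>R P - (P ** S + transpose S ** P)) *v h) =
      2 * (t * (h \<bullet> (P *v h)) - (S *v h) \<bullet> (P *v h))" for t h
  proof -
    have "h \<bullet> (P *v (S *v h)) = (S *v h) \<bullet> (P *v h)"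
      using inner_symmetric_matrix[OF symP, of h "S *v h"] by (simp add: inner_commute)
    moreover have "h \<bullet> (transpose S *v (P *v h)) = (S *v h) \<bullet> (P *v h)"
      using inner_transpose_mult[of S "P *v h" h] by (simp add: inner_commute)
    ultimately show ?thesis
      by (simp add: matrix_vector_mult_diff_rdistrib matrix_vector_mult_add_rdistrib
          scaleR_matrix_vector inner_diff_right inner_add_right
          matrix_vector_mul_assoc[symmetric] del: transpose_matrix_vector)
  qed
  have sym: "transpose ((2 * t) *\<^sub>R P - (P ** S + transpose S ** P)) =
      (2 * t) *\<^sub>R P - (P ** S + transpose S ** P)" for t
    by (simp add: transpose_diff transpose_add transpose_scaleR matrix_transpose_mul symP
        add.commute)
  have iff: "P ** S + transpose S ** P \<preceq>\<^sub>L (2 * t) *\<^sub>R P \<longleftrightarrow> (\<forall>h\<in>-{0}. R h \<le> t)" for t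
  proof -
    have "0 \<le> h \<bullet> (((2 * t) *\<^sub>R P - (P ** S + transpose S ** P)) *v h) \<longleftrightarrow>
        (h \<noteq> 0 \<longrightarrow> R h \<le> t)" for h
      using posP[of h] unfolding form R_def by (cases "h = 0") (auto simp: field_simps)
    then show ?thesis
      unfolding loewner_le_def psd_matrix_def sym by auto
  qed
  have R_le: "R h \<le> \<beta>" if "h \<in> -{0}" for h
    using le[of h] posP[of h] that by (simp add: R_def field_simps)
  have ne: "-{0::real ^ 'm} \<noteq> {}"
    by (metis ComplI axis_eq_0_iff empty_iff singletonD zero_neq_one)
  have bdd: "bdd_above (R ` (-{0}))"
    using R_le by (auto intro!: bdd_aboveI2[of _ _ \<beta>])
  have "log_norm P S = (SUP h\<in>-{0}. R h)"
    unfolding log_norm_def iff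
  proof (rule Least_equality)
    show "\<forall>h\<in>-{0}. R h \<le> (SUP h\<in>-{0}. R h)"
      using bdd by (auto intro: cSUP_upper)
  next
    fix t assume "\<forall>h\<in>-{0}. R h \<le> t"
    then show "(SUP h\<in>-{0}. R h) \<le> t"
      using ne by (auto intro!: cSUP_least)
  qed
  also have "\<dots> \<le> \<beta>"
    using ne R_le by (auto intro!: cSUP_least)
  finally show ?thesis .
qed

text \<open>The increment bound is used at points \<open>z + t *\<^sub>R h\<close>; both of its
  sides scale like the square of \<open>t\<close>, and the limit at 0 gives the quadratic form bound
  for the Jacobian.\<close>

lemma log_norm_jacobian_le:
  fixes F :: "real ^ 'm::finite \<Rightarrow> real ^ 'm"
  assumes P: "pos_def_matrix P"
    and osl: "\<And>y. (F y - F z) \<bullet> (P *v (y - z)) \<le> \<beta> * ((y - z) \<bullet> (P *v (y - z)))"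
    and F: "F differentiable (at z)"
  shows "log_norm P (jacobian F (at z)) \<le> \<beta>"
proof (rule log_norm_le[OF P])
  fix h
  let ?D = "jacobian F (at z) *v h"
  have "(F has_derivative (*v) (jacobian F (at z))) (at z)"
    using F jacobian_works by blast
  then have "((\<lambda>t. F (z + t *\<^sub>R h)) has_derivative
      (\<lambda>t. jacobian F (at z) *v (t *\<^sub>R h))) (at 0)"
    by (intro has_derivative_compose[where g = F and f = "\<lambda>t. z + t *\<^sub>R h"])
       (auto intro!: derivative_eq_intros)
  then have "((\<lambda>t. F (z + t *\<^sub>R h) \<bullet> (P *v h)) has_derivative
      (\<lambda>t. (jacobian F (at z) *v (t *\<^sub>R h)) \<bullet> (P *v h))) (at 0)"
    by (rule has_derivative_inner_left)
  then have "((\<lambda>t. F (z + t *\<^sub>R h) \<bullet> (P *v h)) has_real_derivative ?D \<bullet> (P *v h)) (at 0)"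
    by (simp add: has_field_derivative_def matrix_vector_mult_scaleR mult.commute[of _ "_ \<bullet> _"])
  then have lim: "((\<lambda>t. ((F (z + t *\<^sub>R h) - F z) /\<^sub>R t) \<bullet> (P *v h)) \<longlongrightarrow> ?D \<bullet> (P *v h)) (at 0)"
    by (simp add: DERIV_def inner_diff_left divide_inverse mult.commute)
  have "((F (z + t *\<^sub>R h) - F z) /\<^sub>R t) \<bullet> (P *v h) \<le> \<beta> * (h \<bullet> (P *v h))" if "t \<noteq> 0" for t
  proof -
    let ?l = "((F (z + t *\<^sub>R h) - F z) /\<^sub>R t) \<bullet> (P *v h)"
    \<comment> \<open>The factor is the square of \<open>t\<close> rather than \<open>t\<close>, so
      that the inequality keeps its direction for both signs and the two-sided limit
      applies.\<close>
    have "t\<^sup>2 * ?l = (F (z + t *\<^sub>R h) - F z) \<bullet> (P *v (t *\<^sub>R h))"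
      using that by (simp add: matrix_vector_mult_scaleR power2_eq_square)
    also have "\<dots> \<le> t\<^sup>2 * (\<beta> * (h \<bullet> (P *v h)))"
      using osl[of "z + t *\<^sub>R h"]
      by (simp add: matrix_vector_mult_scaleR power2_eq_square mult_ac)
    finally have "t\<^sup>2 * ?l \<le> t\<^sup>2 * (\<beta> * (h \<bullet> (P *v h)))" .
    then show ?thesis
      using that by simp
  qed
  then have "\<forall>\<^sub>F t in at 0. ((F (z + t *\<^sub>R h) - F z) /\<^sub>R t) \<bullet> (P *v h) \<le> \<beta> * (h \<bullet> (P *v h))"
    by (simp add: eventually_at_filter)
  then show "?D \<bullet> (P *v h) \<le> \<beta> * (h \<bullet> (P *v h))"
    using lim tendsto_upperbound trivial_limit_at by blast
qed

subsection \<open>Smooth strongly convex functions\<close>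

text \<open>Makes the description in \<open>gradient\<close> usable: the derivative is a linear
  functional, represented by the vector \<open>adjoint f' 1\<close>, and uniqueness of the
  derivative makes this vector unique.\<close>

lemma GDERIV_gradient:
  assumes "f differentiable (at x)"
  shows "GDERIV f x :> gradient f x"
proof -
  obtain f' where f': "(f has_derivative f') (at x)"
    using assms by (auto simp: differentiable_def)
  then have "linear f'"
    using has_derivative_linear by blast
  then have "f' = (\<lambda>h. h \<bullet> (adjoint f' 1))"
    by (simp add: fun_eq_iff adjoint_works)
  then have "GDERIV f x :> adjoint f' 1"
    using f' by (simp add: gderiv_def)
  then show ?thesis
    unfolding gradient_def
  proof (rule theI)
    fix D assume "GDERIV f x :> D"
    then have "(\<lambda>h. h \<bullet> D) = (\<lambda>h. h \<bullet> adjoint f' 1)"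
      using \<open>GDERIV f x :> adjoint f' 1\<close> has_derivative_unique unfolding gderiv_def by blast
    then show "D = adjoint f' 1"
      by (metis vector_eq_ldot)
  qed
qed

lemma DERIV_along_line:
  assumes "\<And>x. f differentiable (at x)"
  shows "((\<lambda>t. f (x + t *\<^sub>R d)) has_real_derivative gradient f (x + t *\<^sub>R d) \<bullet> d) (at t)"
proof -
  have "(f has_derivative (\<lambda>h. h \<bullet> gradient f (x + t *\<^sub>R d))) (at (x + t *\<^sub>R d))"
    using GDERIV_gradient[OF assms] by (simp add: gderiv_def)
  then have "((\<lambda>t. f (x + t *\<^sub>R d)) has_derivative
      (\<lambda>s. (s *\<^sub>R d) \<bullet> gradient f (x + t *\<^sub>R d))) (at t)"
    by (intro has_derivative_compose[where g = f and f = "\<lambda>t. x + t *\<^sub>R d"])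
       (auto intro!: derivative_eq_intros)
  then show ?thesis
    by (simp add: has_field_derivative_def inner_commute mult.commute[of _ "_ \<bullet> _"])
qed

text \<open>Along the line from \<open>x\<close> in direction \<open>d\<close>, the convex function
  \<open>h\<close> lies above its tangent at parameter 0; at parameter 1 the subtracted squares
  leave exactly the quadratic term in \<open>d\<close>.\<close>

lemma strongly_convex_lower_bound:
  assumes "strongly_convex \<rho> f" and diff: "\<And>x. f differentiable (at x)"
  shows "f x + gradient f x \<bullet> d + \<rho> / 2 * (norm d)\<^sup>2 \<le> f (x + d)"
proof -
  define h where "h x = f x - \<rho> / 2 * (norm x)\<^sup>2" for x
  have conv: "convex_on UNIV h"
    using assms(1) by (simp add: strongly_convex_def h_def[abs_def])
  have "convex_on UNIV (\<lambda>t::real. h (x + t *\<^sub>R d))"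
  proof (rule convex_onI)
    fix s a b' :: real
    assume "0 < s" "s < 1"
    then show "h (x + ((1 - s) *\<^sub>R a + s *\<^sub>R b') *\<^sub>R d) \<le>
        (1 - s) * h (x + a *\<^sub>R d) + s * h (x + b' *\<^sub>R d)"
      using convex_onD[OF conv, of s "x + a *\<^sub>R d" "x + b' *\<^sub>R d"]
      by (simp add: algebra_simps)
  qed simp
  moreover have "((\<lambda>t. h (x + t *\<^sub>R d)) has_real_derivative
      (gradient f x \<bullet> d - \<rho> * (x \<bullet> d))) (at 0)"
  proof -
    have "((\<lambda>t. (x + t *\<^sub>R d) \<bullet> (x + t *\<^sub>R d)) has_real_derivative 2 * (x \<bullet> d)) (at 0)"
      unfolding has_field_derivative_def
      by (auto intro!: derivative_eq_intros simp: inner_commute)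
    from DERIV_diff[OF DERIV_along_line[OF diff, of x d 0] DERIV_cmult[OF this, of "\<rho> / 2"]]
    show ?thesis
      by (simp add: h_def power2_norm_eq_inner)
  qed
  ultimately have "gradient f x \<bullet> d - \<rho> * (x \<bullet> d) \<le> h (x + d) - h x"
    using convex_on_imp_above_tangent[of UNIV "\<lambda>t. h (x + t *\<^sub>R d)" 0
        1 "gradient f x \<bullet> d - \<rho> * (x \<bullet> d)"] by simp
  then show ?thesis
    by (simp add: h_def power2_norm_eq_inner inner_add_left inner_add_right inner_commute
        field_simps)
qed

text \<open>The descent lemma. The gap \<open>\<phi>\<close> between \<open>f\<close> and its
  quadratic model along the segment has nonpositive derivative, by the Lipschitz bound and
  Cauchy-Schwarz.\<close>

lemma L_smooth_upper_bound:
  assumes "L_smooth L f"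
  shows "f (x + d) \<le> f x + gradient f x \<bullet> d + L / 2 * (norm d)\<^sup>2"
proof -
  have diff: "\<And>x. f differentiable (at x)" and lip: "L-lipschitz_on UNIV (gradient f)"
    using assms by (auto simp: L_smooth_def)
  define \<phi> where "\<phi> t = f (x + t *\<^sub>R d) - t * (gradient f x \<bullet> d) - L / 2 * t\<^sup>2 * (norm d)\<^sup>2" for t
  have "\<phi> 1 \<le> \<phi> 0"
  proof (rule DERIV_nonpos_imp_nonincreasing[of 0 1 \<phi>])
    fix t :: real assume "0 \<le> t" "t \<le> 1"
    let ?D = "(gradient f (x + t *\<^sub>R d) - gradient f x) \<bullet> d - L * t * (norm d)\<^sup>2"
    have "(\<phi> has_real_derivative ?D) (at t)"
      unfolding \<phi>_def
      by (rule derivative_eq_intros DERIV_along_line[OF diff] refl)+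
         (simp add: inner_diff_left)
    moreover have "?D \<le> 0"
    proof -
      have "norm (gradient f (x + t *\<^sub>R d) - gradient f x) \<le> L * (t * norm d)"
        using lipschitz_onD[OF lip, of "x + t *\<^sub>R d" x] \<open>0 \<le> t\<close> by (simp add: dist_norm)
      then have "norm (gradient f (x + t *\<^sub>R d) - gradient f x) * norm d \<le> L * (t * norm d) * norm d"
        by (rule mult_right_mono) simp
      then show ?thesis
        using norm_cauchy_schwarz[of "gradient f (x + t *\<^sub>R d) - gradient f x" d]
        by (simp add: power2_eq_square mult_ac)
    qed
    ultimately show "\<exists>y. (\<phi> has_real_derivative y) (at t) \<and> y \<le> 0"
      by blast
  qed simp
  then show ?thesis
    by (simp add: \<phi>_def)
qed

text \<open>Adding the lower bounds based at \<open>x\<close> and at \<open>y\<close> cancels the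
  function values.\<close>

lemma strongly_convex_gradient_monotone:
  assumes "strongly_convex \<rho> f" and diff: "\<And>x. f differentiable (at x)"
  shows "\<rho> * (norm (y - x))\<^sup>2 \<le> (gradient f y - gradient f x) \<bullet> (y - x)"
  using strongly_convex_lower_bound[OF assms, of x "y - x"]
    strongly_convex_lower_bound[OF assms, of y "x - y"]
  by (simp add: inner_diff_left inner_diff_right norm_minus_commute)

text \<open>Baillon--Haddad: compare the tangent at \<open>x\<close> with the quadratic upper bound at \<open>y\<close>,
  both evaluated at the gradient step \<open>y - (gradient f y - gradient f x) / L\<close>.\<close>

lemma gradient_cocoercive:
  assumes cvx: "strongly_convex \<rho> f" and "0 \<le> \<rho>" and smooth: "L_smooth L f" and "0 < L"
  shows "(norm (gradient f y - gradient f x))\<^sup>2 \<le> L * ((gradient f y - gradient f x) \<bullet> (y - x))"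
proof -
  have diff: "\<And>x. f differentiable (at x)"
    using smooth by (auto simp: L_smooth_def)
  have half: "f x + gradient f x \<bullet> (y - x) + (norm (gradient f y - gradient f x))\<^sup>2 / (2 * L) \<le> f y"
    for x y
  proof -
    define g where "g = gradient f y - gradient f x"
    define s where "s = y - (1 / L) *\<^sub>R g"
    have "f x + gradient f x \<bullet> (s - x) \<le> f s"
    proof -
      have "0 \<le> \<rho> / 2 * (norm (s - x))\<^sup>2"
        using \<open>0 \<le> \<rho>\<close> by simp
      then show ?thesis
        using strongly_convex_lower_bound[OF cvx diff, of x "s - x"]
        by (simp only: add.commute[of x] diff_add_cancel)
    qed
    moreover have "f s \<le> f y - gradient f y \<bullet> g / L + (norm g)\<^sup>2 / (2 * L)"
      using L_smooth_upper_bound[OF smooth, of y "- (1 / L) *\<^sub>R g"] \<open>0 < L\<close>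
      by (simp add: s_def power2_eq_square field_simps)
    moreover have "gradient f x \<bullet> (s - x) = gradient f x \<bullet> (y - x) - gradient f x \<bullet> g / L"
      by (simp add: s_def inner_diff_right)
    moreover have "(gradient f y \<bullet> g - gradient f x \<bullet> g) / L = (norm g)\<^sup>2 / L"
      by (simp add: g_def power2_norm_eq_inner inner_diff_left)
    ultimately show ?thesis
      unfolding g_def[symmetric] by (simp add: diff_divide_distrib)
  qed
  \<comment> \<open>Adding \<open>half\<close> to itself with the points exchanged cancels the
    function values and turns the factor \<open>1 / (2 * L)\<close> into
    \<open>1 / L\<close>.\<close>
  show ?thesis
    using half[of x y] half[of y x] \<open>0 < L\<close>
    by (simp add: inner_diff_left inner_diff_right norm_minus_commute field_simps)
qed

subsection \<open>The primal-dual flow\<close>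

lemma loewner_bounds_transpose:
  fixes A :: "real ^ 'n ^ 'p"
  shows "a *\<^sub>R mat 1 \<preceq>\<^sub>L A ** transpose A \<Longrightarrow> a * (norm w)\<^sup>2 \<le> (norm (transpose A *v w))\<^sup>2"
    and "A ** transpose A \<preceq>\<^sub>L a *\<^sub>R mat 1 \<Longrightarrow> (norm (transpose A *v w))\<^sup>2 \<le> a * (norm w)\<^sup>2"
proof -
  have AA: "w \<bullet> ((A ** transpose A) *v w) = (norm (transpose A *v w))\<^sup>2"
    using inner_transpose_mult[of A w "transpose A *v w"]
    by (simp add: matrix_vector_mul_assoc[symmetric] power2_norm_eq_inner
        del: transpose_matrix_vector)
  have aI: "w \<bullet> ((a *\<^sub>R mat 1) *v w) = a * (norm w)\<^sup>2"
    by (simp add: scaleR_matrix_vector power2_norm_eq_inner)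
  have "B \<preceq>\<^sub>L C \<Longrightarrow> w \<bullet> (B *v w) \<le> w \<bullet> (C *v w)" for B C
    by (simp add: loewner_le_def psd_matrix_def matrix_vector_mult_diff_rdistrib inner_diff_right)
  from this[of "a *\<^sub>R mat 1" "A ** transpose A"] this[of "A ** transpose A" "a *\<^sub>R mat 1"]
  show "a *\<^sub>R mat 1 \<preceq>\<^sub>L A ** transpose A \<Longrightarrow> a * (norm w)\<^sup>2 \<le> (norm (transpose A *v w))\<^sup>2"
    and "A ** transpose A \<preceq>\<^sub>L a *\<^sub>R mat 1 \<Longrightarrow> (norm (transpose A *v w))\<^sup>2 \<le> a * (norm w)\<^sup>2"
    unfolding AA aI by blast+
qed

text \<open>A matrix and its transpose have the same operator norm: write the squared norm of
  \<open>A *v x\<close> as an inner product with \<open>x\<close>, apply Cauchy-Schwarz, square, and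
  cancel one factor.\<close>

lemma transpose_bound_imp_bound:
  fixes A :: "real ^ 'n ^ 'p"
  assumes "\<And>w. (norm (transpose A *v w))\<^sup>2 \<le> a * (norm w)\<^sup>2"
  shows "(norm (A *v x))\<^sup>2 \<le> a * (norm x)\<^sup>2"
proof (cases "A *v x = 0")
  case True
  \<comment> \<open>Here only \<open>0 \<le> a\<close> is at stake; it follows by testing the
    assumption on a unit vector.\<close>
  then show ?thesis
    using order_trans[OF zero_le_power2 assms[of "axis undefined 1"]] by (simp add: norm_axis_1)
next
  case False
  let ?y = "A *v x"
  have "(norm ?y)\<^sup>2 = (transpose A *v ?y) \<bullet> x"
    by (simp add: inner_transpose_mult power2_norm_eq_inner del: transpose_matrix_vector)
  also have "\<dots> \<le> norm (transpose A *v ?y) * norm x"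
    by (rule norm_cauchy_schwarz)
  finally have "((norm ?y)\<^sup>2)\<^sup>2 \<le> (norm (transpose A *v ?y) * norm x)\<^sup>2"
    by (intro power_mono) auto
  also have "\<dots> \<le> (a * (norm ?y)\<^sup>2) * (norm x)\<^sup>2"
    using assms[of ?y] by (simp add: power_mult_distrib mult_right_mono del: transpose_matrix_vector)
  finally have "(norm ?y)\<^sup>2 * (norm ?y)\<^sup>2 \<le> (norm ?y)\<^sup>2 * (a * (norm x)\<^sup>2)"
    by (simp add: power2_eq_square mult_ac)
  then show ?thesis
    by (rule mult_left_le_imp_le) (use False in simp)
qed

text \<open>The function \<open>f\<close> stays outside, so that the key inequalities concern
  arbitrary vectors in place of gradient increments. This is why \<open>\<rho> \<le> L\<close>, a
  consequence of the properties of \<open>f\<close>, is assumed here and supplied at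
  interpretation.\<close>

locale primal_dual_gains =
  fixes A :: "real ^ 'n::finite ^ 'p::finite"
    and \<rho> L a_min a_max kp ki kd \<alpha> c :: real
    and M :: "real ^ 'n ^ 'n"
  assumes \<rho>_pos: "0 < \<rho>" and L_pos: "0 < L" and \<rho>_le_L: "\<rho> \<le> L"
    and a_min_pos: "0 < a_min" and a_max_pos: "0 < a_max"
    and transpose_lower: "\<And>w. a_min * (norm w)\<^sup>2 \<le> (norm (transpose A *v w))\<^sup>2"
    and transpose_upper: "\<And>w. (norm (transpose A *v w))\<^sup>2 \<le> a_max * (norm w)\<^sup>2"
    and kp: "0 \<le> kp" and ki: "0 < ki" and kd: "0 \<le> kd"
    and M_def: "M = mat 1 + kd *\<^sub>R (transpose A ** A)"
    and \<alpha>_def: "\<alpha> = 1 / 2 * min (1 / (L + kp * a_max)) (\<rho> / (ki * a_max))"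
    and c_def: "c = 1 / 2 * \<alpha> * ki * (a_min / (1 + kd * a_max))"
begin

section \<open>Consequences of the choice of gains\<close>

lemma A_upper: "(norm (A *v x))\<^sup>2 \<le> a_max * (norm x)\<^sup>2"
  by (rule transpose_bound_imp_bound) (rule transpose_upper)

lemma a_min_le_a_max: "a_min \<le> a_max"
  using transpose_lower[of "axis undefined 1"] transpose_upper[of "axis undefined 1"]
  by (simp add: norm_axis_1 del: transpose_matrix_vector)

lemma gain_pos: "0 < L + kp * a_max" "0 < 1 + kd * a_max"
  using L_pos kp kd a_max_pos by (auto intro: add_pos_nonneg)

lemma \<alpha>_pos: "0 < \<alpha>"
  using gain_pos \<rho>_pos ki a_max_pos by (simp add: \<alpha>_def)

lemma c_pos: "0 < c"
  using gain_pos \<alpha>_pos ki a_min_pos by (simp add: c_def)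

text \<open>The first entry of the minimum in \<open>\<alpha>\<close> tames the penalized gradient
  increment.\<close>

lemma \<alpha>_gain_le: "\<alpha> * (L + kp * a_max) \<le> 1 / 2"
proof -
  have "\<alpha> \<le> 1 / 2 * (1 / (L + kp * a_max))"
    unfolding \<alpha>_def by (intro mult_left_mono min.cobounded1) simp
  then show ?thesis
    using gain_pos by (simp add: field_simps)
qed

text \<open>The second entry of the minimum in \<open>\<alpha>\<close> lets strong convexity pay for
  the positive term \<open>\<alpha> * ki * (norm (A *v u))\<^sup>2\<close> created by the
  off-diagonal blocks of \<open>P\<close>.\<close>

lemma \<alpha>_ki_le: "\<alpha> * ki * a_max \<le> \<rho> / 2"
proof -
  have "\<alpha> \<le> 1 / 2 * (\<rho> / (ki * a_max))"
    unfolding \<alpha>_def by (intro mult_left_mono min.cobounded2) simp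
  then show ?thesis
    using ki a_max_pos by (simp add: field_simps)
qed

lemma c_le: "c * (1 + kd * a_max) \<le> \<rho> / 4"
proof -
  have "c * (1 + kd * a_max) = \<alpha> * ki * a_min / 2"
    using gain_pos unfolding c_def by (simp add: field_simps del: distrib_left_numeral)
  also have "\<dots> \<le> \<alpha> * ki * a_max / 2"
    using a_min_le_a_max \<alpha>_pos ki by simp
  finally show ?thesis
    using \<alpha>_ki_le by simp
qed

section \<open>The matrix \<open>M\<close> and its inverse\<close>

lemma M_mult: "M *v x = x + kd *\<^sub>R (transpose A *v (A *v x))"
  by (simp add: M_def matrix_vector_mult_add_rdistrib scaleR_matrix_vector
      matrix_vector_mul_assoc[symmetric] del: transpose_matrix_vector)

lemma transpose_M: "transpose M = M"
  by (simp add: M_def transpose_add transpose_scaleR matrix_transpose_mul)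

lemma M_form: "x \<bullet> (M *v x) = (norm x)\<^sup>2 + kd * (norm (A *v x))\<^sup>2"
  using inner_transpose_mult[of A "A *v x" x]
  by (simp add: M_mult inner_add_right power2_norm_eq_inner inner_commute
      del: transpose_matrix_vector)

lemma M_lower: "(norm x)\<^sup>2 \<le> x \<bullet> (M *v x)"
  using kd by (simp add: M_form)

lemma M_upper: "x \<bullet> (M *v x) \<le> (1 + kd * a_max) * (norm x)\<^sup>2"
  using mult_left_mono[OF A_upper[of x] kd] by (simp add: M_form algebra_simps)

text \<open>Since the form of \<open>M\<close> dominates the squared norm, \<open>M\<close> has
  trivial kernel and is invertible; only then does the choice inside \<open>matrix_inv\<close> give
  a true inverse.\<close>

lemma M_mult_inv: "M *v (matrix_inv M *v y) = y"
proof -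
  have "x = 0" if "M *v x = 0" for x
    using M_lower[of x] that by simp
  then have "invertible M"
    using invertible_left_inverse matrix_left_invertible_ker by blast
  then have "M ** matrix_inv M = mat 1"
    unfolding matrix_inv_def invertible_def by (rule someI2_ex) simp
  then show ?thesis
    by (simp add: matrix_vector_mul_assoc)
qed

lemma inner_M: "(M *v x) \<bullet> y = x \<bullet> (M *v y)"
  by (rule inner_symmetric_matrix[OF transpose_M])

text \<open>A lower bound for \<open>A M\<^sup>-\<^sup>1 A\<^sup>T\<close>: test the positive form of \<open>M\<close> at
  \<open>M\<^sup>-\<^sup>1 y - y / (1 + kd * a_max)\<close>, where \<open>y = A\<^sup>T w\<close>.\<close>

lemma dual_form_lower:
  assumes Mp: "M *v p = transpose A *v w"
  shows "a_min / (1 + kd * a_max) * (norm w)\<^sup>2 \<le> p \<bullet> (transpose A *v w)"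
proof -
  define y where "y = transpose A *v w"
  \<comment> \<open>With this \<open>s\<close> the upper bound on the quadratic term in
    \<open>y\<close> collapses to \<open>s * (norm y)\<^sup>2\<close>, which cancels half of the
    cross term.\<close>
  define s where "s = 1 / (1 + kd * a_max)"
  have s: "0 < s" "s * (1 + kd * a_max) = 1"
    using gain_pos by (auto simp: s_def)
  have Mp': "M *v p = y"
    using Mp by (simp add: y_def)
  have "0 \<le> (p - s *\<^sub>R y) \<bullet> (M *v (p - s *\<^sub>R y))"
    using M_lower[of "p - s *\<^sub>R y"] order_trans[OF zero_le_power2] by blast
  also have "\<dots> = p \<bullet> y - 2 * s * (norm y)\<^sup>2 + s\<^sup>2 * (y \<bullet> (M *v y))"
    using inner_M[of p y] unfolding power2_norm_eq_inner
    by (simp add: matrix_vector_mult_diff_distrib matrix_vector_mult_scaleR Mp' inner_diff_left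
        inner_diff_right power2_eq_square algebra_simps del: dot_square_norm)
  also have "s\<^sup>2 * (y \<bullet> (M *v y)) \<le> s\<^sup>2 * ((1 + kd * a_max) * (norm y)\<^sup>2)"
    by (intro mult_left_mono M_upper) simp
  also have "\<dots> = s * (norm y)\<^sup>2"
    using s by (simp add: power2_eq_square mult.assoc)
  finally have "s * (norm y)\<^sup>2 \<le> p \<bullet> y"
    by simp
  moreover have "s * (a_min * (norm w)\<^sup>2) \<le> s * (norm y)\<^sup>2"
    using s transpose_lower[of w] by (simp add: y_def del: transpose_matrix_vector)
  ultimately show ?thesis
    by (simp add: s_def y_def del: transpose_matrix_vector)
qed

text \<open>Cocoercivity constants add: \<open>r\<close> is the increment of the gradient of
  \<open>f\<close> plus the quadratic penalty, and the two summands have constants \<open>L\<close>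
  and \<open>kp * a_max\<close>.\<close>

lemma penalized_cocoercive:
  fixes g u :: "real ^ 'n"
  assumes coc: "(norm g)\<^sup>2 \<le> L * (g \<bullet> u)"
  defines "r \<equiv> g + kp *\<^sub>R (transpose A *v (A *v u))"
  shows "(norm r)\<^sup>2 \<le> (L + kp * a_max) * (u \<bullet> r)"
proof -
  define h where "h = transpose A *v (A *v u)"
  have h: "(norm h)\<^sup>2 \<le> a_max * (norm (A *v u))\<^sup>2" and uh: "u \<bullet> h = (norm (A *v u))\<^sup>2"
    using transpose_upper[of "A *v u"] inner_transpose_mult[of A "A *v u" u]
    by (auto simp: h_def power2_norm_eq_inner inner_commute simp del: transpose_matrix_vector)
  \<comment> \<open>The weights \<open>a_max\<close> and \<open>L\<close> balance the two
    cocoercivity bounds, so that the common factor \<open>a_max * L\<close> can be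
    cancelled.\<close>
  have "0 \<le> (norm (a_max *\<^sub>R g - L *\<^sub>R h))\<^sup>2"
    by simp
  then have "2 * (a_max * L) * (g \<bullet> h) \<le> a_max\<^sup>2 * (norm g)\<^sup>2 + L\<^sup>2 * (norm h)\<^sup>2"
    unfolding power2_norm_eq_inner
    by (simp add: inner_diff_left inner_diff_right inner_commute power2_eq_square algebra_simps
        del: dot_square_norm)
  also have "\<dots> \<le> a_max\<^sup>2 * (L * (g \<bullet> u)) + L\<^sup>2 * (a_max * (norm (A *v u))\<^sup>2)"
    by (intro add_mono mult_left_mono coc h) auto
  finally have "(a_max * L) * (2 * (g \<bullet> h)) \<le>
      (a_max * L) * (a_max * (g \<bullet> u) + L * (norm (A *v u))\<^sup>2)"
    by (simp add: power2_eq_square algebra_simps)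
  then have cross: "2 * (g \<bullet> h) \<le> a_max * (g \<bullet> u) + L * (norm (A *v u))\<^sup>2"
    using a_max_pos L_pos by simp
  have "(norm r)\<^sup>2 = (norm g)\<^sup>2 + kp * (2 * (g \<bullet> h)) + kp\<^sup>2 * (norm h)\<^sup>2"
    unfolding r_def h_def[symmetric] power2_norm_eq_inner
    by (simp add: inner_add_left inner_add_right inner_commute power2_eq_square algebra_simps
        del: dot_square_norm)
  also have "\<dots> \<le> L * (g \<bullet> u) + kp * (a_max * (g \<bullet> u) + L * (norm (A *v u))\<^sup>2)
      + kp\<^sup>2 * (a_max * (norm (A *v u))\<^sup>2)"
    using kp by (intro add_mono mult_left_mono coc h cross) auto
  also have "\<dots> = (L + kp * a_max) * (u \<bullet> r)"
    unfolding r_def h_def[symmetric]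
    by (simp add: inner_add_right uh inner_commute[of u g] power2_eq_square algebra_simps)
  finally show ?thesis .
qed

text \<open>Here \<open>u\<close>, \<open>w\<close>, \<open>g\<close> are the increments of \<open>x\<close>, \<open>\<nu>\<close>
  and \<open>gradient f x\<close>, and \<open>p = M\<^sup>-\<^sup>1 A\<^sup>T w\<close>.  Both mixed terms in \<open>u\<close> and
  \<open>p\<close> are absorbed at once by completing the square at \<open>e = p - 2 c u\<close>.\<close>

lemma contraction_form:
  fixes g u p :: "real ^ 'n" and w :: "real ^ 'p"
  assumes coc: "(norm g)\<^sup>2 \<le> L * (g \<bullet> u)" and mono: "\<rho> * (norm u)\<^sup>2 \<le> g \<bullet> u"
    and Mp: "M *v p = transpose A *v w"
  defines "r \<equiv> g + kp *\<^sub>R (transpose A *v (A *v u))"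
  defines "y \<equiv> transpose A *v w"
  shows "c * (u \<bullet> (M *v u) + 2 * \<alpha> * (u \<bullet> y) + (norm w)\<^sup>2 / ki) + \<alpha> * ki * (norm (A *v u))\<^sup>2
    \<le> u \<bullet> r + \<alpha> * (p \<bullet> r) + \<alpha> * (p \<bullet> y)"
proof -
  let ?U = "(norm u)\<^sup>2" and ?m = "u \<bullet> (M *v u)" and ?e = "p - (2 * c) *\<^sub>R u"
  have Mp': "M *v p = y"
    using Mp by (simp add: y_def)
  have G: "\<rho> * ?U \<le> u \<bullet> r"
    using mono kp inner_transpose_mult[of A "A *v u" u]
    by (simp add: r_def inner_add_right inner_commute add_increasing2
        del: transpose_matrix_vector)
  then have G_nonneg: "0 \<le> u \<bullet> r"
    using \<rho>_pos order_trans[of 0 "\<rho> * ?U"] by simp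
  have "\<alpha> * (norm r)\<^sup>2 \<le> \<alpha> * ((L + kp * a_max) * (u \<bullet> r))"
    unfolding r_def using \<alpha>_pos by (intro mult_left_mono penalized_cocoercive coc) auto
  also have "\<dots> \<le> 1 / 2 * (u \<bullet> r)"
    using mult_right_mono[OF \<alpha>_gain_le G_nonneg] by (simp add: mult.assoc)
  finally have R: "\<alpha> * (norm r)\<^sup>2 \<le> 1 / 2 * (u \<bullet> r)" .
  have "\<alpha> * ki * (norm (A *v u))\<^sup>2 \<le> \<alpha> * ki * (a_max * ?U)"
    using \<alpha>_pos ki by (intro mult_left_mono A_upper) auto
  also have "\<dots> \<le> \<rho> / 2 * ?U"
    using mult_right_mono[OF \<alpha>_ki_le, of ?U] by (simp add: mult.assoc)
  finally have a: "\<alpha> * ki * (norm (A *v u))\<^sup>2 \<le> \<rho> / 2 * ?U" .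
  have "c * ?m \<le> c * ((1 + kd * a_max) * ?U)"
    using c_pos by (intro mult_left_mono M_upper) auto
  also have "\<dots> \<le> \<rho> / 4 * ?U"
    using mult_right_mono[OF c_le, of ?U] by (simp add: mult.assoc)
  finally have m: "c * ?m \<le> \<rho> / 4 * ?U" .
  have W: "c * ((norm w)\<^sup>2 / ki) \<le> \<alpha> / 2 * (p \<bullet> y)"
  proof -
    have "c * ((norm w)\<^sup>2 / ki) = \<alpha> / 2 * (a_min / (1 + kd * a_max) * (norm w)\<^sup>2)"
      using ki by (simp add: c_def)
    also have "\<dots> \<le> \<alpha> / 2 * (p \<bullet> y)"
      unfolding y_def using \<alpha>_pos by (intro mult_left_mono dual_form_lower Mp) auto
    finally show ?thesis .
  qed
  have e_form: "?e \<bullet> (M *v ?e) = p \<bullet> y - 4 * c * (u \<bullet> y) + 4 * c\<^sup>2 * ?m"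
    using inner_M[of p u]
    by (simp add: matrix_vector_mult_diff_distrib matrix_vector_mult_scaleR Mp' inner_diff_left
        inner_diff_right power2_eq_square inner_commute algebra_simps)
  \<comment> \<open>Passing from the norm of \<open>?e\<close> to its \<open>M\<close>-form brings
    in \<open>M *v p = y\<close>; scaled by \<open>\<alpha> / 2\<close>, its cross term is exactly
    the mixed term of the \<open>P\<close>-form times \<open>c\<close>.\<close>
  have "0 \<le> (norm (?e + r))\<^sup>2"
    by simp
  also have "\<dots> = (norm ?e)\<^sup>2 + 2 * (?e \<bullet> r) + (norm r)\<^sup>2"
    by (simp only: power2_norm_eq_inner inner_add_left inner_add_right inner_commute)
  also have "\<dots> \<le> ?e \<bullet> (M *v ?e) + 2 * (?e \<bullet> r) + (norm r)\<^sup>2"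
    using M_lower[of ?e] by simp
  also have "\<dots> = p \<bullet> y - 4 * c * (u \<bullet> y) + 4 * c\<^sup>2 * ?m
      + 2 * (p \<bullet> r) - 4 * c * (u \<bullet> r) + (norm r)\<^sup>2"
    by (simp only: e_form) (simp add: inner_diff_left)
  finally have "0 \<le> \<alpha> / 2 * (p \<bullet> y - 4 * c * (u \<bullet> y) + 4 * c\<^sup>2 * ?m
      + 2 * (p \<bullet> r) - 4 * c * (u \<bullet> r) + (norm r)\<^sup>2)"
    using \<alpha>_pos by simp
  then have e: "0 \<le> \<alpha> / 2 * (p \<bullet> y) - 2 * c * \<alpha> * (u \<bullet> y) + 2 * \<alpha> * c * (c * ?m)
      + \<alpha> * (p \<bullet> r) - 2 * \<alpha> * c * (u \<bullet> r) + (\<alpha> * (norm r)\<^sup>2) / 2"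
    by (simp add: power2_eq_square algebra_simps)
  \<comment> \<open>The second-order term in \<open>c\<close> is paid for by the negative
    \<open>u \<bullet> r\<close> term coming from the shift of \<open>p\<close>.\<close>
  have "2 * \<alpha> * c * (c * ?m) \<le> 2 * \<alpha> * c * (\<rho> / 4 * ?U)"
    using \<alpha>_pos c_pos by (intro mult_left_mono m) auto
  also have "\<dots> \<le> 2 * \<alpha> * c * (u \<bullet> r)"
    using \<alpha>_pos c_pos G G_nonneg by (intro mult_left_mono) auto
  finally have "2 * \<alpha> * c * (c * ?m) \<le> 2 * \<alpha> * c * (u \<bullet> r)" .
  \<comment> \<open>The budget is spent exactly: of \<open>u \<bullet> r\<close>, one half goes to
    \<open>a\<close>, one quarter to \<open>m\<close> and one quarter to \<open>R\<close>; of
    \<open>\<alpha> * (p \<bullet> y)\<close>, one half goes to \<open>W\<close> and one half to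
    \<open>e\<close>.\<close>
  then have "\<alpha> * ki * (norm (A *v u))\<^sup>2 + c * ?m + 2 * c * \<alpha> * (u \<bullet> y) + c * ((norm w)\<^sup>2 / ki)
      \<le> u \<bullet> r + \<alpha> * (p \<bullet> r) + \<alpha> * (p \<bullet> y)"
    using e W m a R G by argo
  then show ?thesis
    by (simp add: algebra_simps)
qed

section \<open>The weight matrix \<open>P\<close>\<close>

abbreviation P :: "real ^ ('n + 'p) ^ ('n + 'p)" where
  "P \<equiv> block_mat M (\<alpha> *\<^sub>R transpose A) (\<alpha> *\<^sub>R A) ((1 / ki) *\<^sub>R mat 1)"

lemma P_mult:
  "P *v block_vec u w =
    block_vec (M *v u + \<alpha> *\<^sub>R (transpose A *v w)) (\<alpha> *\<^sub>R (A *v u) + (1 / ki) *\<^sub>R w)"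
  by (simp add: block_mat_mult_block_vec scaleR_matrix_vector del: transpose_matrix_vector)

lemma P_form:
  "block_vec u w \<bullet> (P *v block_vec u w) =
    u \<bullet> (M *v u) + 2 * \<alpha> * (u \<bullet> (transpose A *v w)) + (norm w)\<^sup>2 / ki"
  using inner_transpose_mult[of A w u]
  by (simp add: P_mult inner_block_vec inner_add_right inner_commute power2_norm_eq_inner
      del: transpose_matrix_vector)

text \<open>Young's inequality absorbs the cross term into half of each diagonal term. The smallness
  needed combines \<open>\<alpha>_ki_le\<close> with \<open>\<alpha> * \<rho> \<le> 1 / 2\<close>,
  where \<open>\<rho> \<le> L\<close> enters.\<close>

lemma pos_def_P: "pos_def_matrix P"
  unfolding pos_def_matrix_def
proof (intro conjI allI impI)
  show "transpose P = P"
    by (simp add: transpose_block_mat transpose_M transpose_scaleR)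
next
  fix v :: "real ^ ('n + 'p)" assume "v \<noteq> 0"
  define u w where "u = vec_Inl v" and "w = vec_Inr v"
  have v: "v = block_vec u w"
    by (simp add: u_def w_def)
  have nz: "u \<noteq> 0 \<or> w \<noteq> 0"
    using \<open>v \<noteq> 0\<close> unfolding v by auto
  have "\<alpha> * \<rho> \<le> \<alpha> * (L + kp * a_max)"
    using \<alpha>_pos \<rho>_le_L kp a_max_pos by (intro mult_left_mono) (auto intro: add_increasing2)
  then have \<alpha>\<rho>: "\<alpha> * \<rho> \<le> 1 / 2"
    using \<alpha>_gain_le by simp
  have "\<alpha>\<^sup>2 * ki * (norm (A *v u))\<^sup>2 \<le> \<alpha>\<^sup>2 * ki * (a_max * (norm u)\<^sup>2)"
    using ki by (intro mult_left_mono A_upper) auto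
  also have "\<dots> = \<alpha> * (\<alpha> * ki * a_max) * (norm u)\<^sup>2"
    by (simp add: power2_eq_square)
  also have "\<dots> \<le> \<alpha> * (\<rho> / 2) * (norm u)\<^sup>2"
    using \<alpha>_pos \<alpha>_ki_le by (intro mult_right_mono mult_left_mono) auto
  also have "\<dots> \<le> 1 / 4 * (norm u)\<^sup>2"
    using \<alpha>\<rho> by (intro mult_right_mono) auto
  finally have au: "\<alpha>\<^sup>2 * ki * (norm (A *v u))\<^sup>2 \<le> 1 / 4 * (norm u)\<^sup>2" .
  \<comment> \<open>The coefficient \<open>2 * \<alpha> * ki\<close> makes the square reproduce the
    cross term of the \<open>P\<close>-form while using only half of the \<open>w\<close>
    term.\<close>
  have "0 \<le> (norm ((2 * \<alpha> * ki) *\<^sub>R (A *v u) + w))\<^sup>2 / (2 * ki)"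
    using ki by simp
  also have "\<dots> = 2 * (\<alpha>\<^sup>2 * ki * (norm (A *v u))\<^sup>2) + 2 * \<alpha> * (w \<bullet> (A *v u)) + (norm w)\<^sup>2 / (2 * ki)"
    using ki unfolding power2_norm_eq_inner
    by (simp add: inner_add_left inner_add_right inner_commute power2_eq_square field_simps
        del: dot_square_norm)
  finally have "(norm u)\<^sup>2 / 2 + (norm w)\<^sup>2 / (2 * ki) \<le> v \<bullet> (P *v v)"
    using M_lower[of u] au inner_transpose_mult[of A w u]
    unfolding v P_form by (simp add: inner_commute field_simps del: transpose_matrix_vector)
  moreover have "0 < (norm u)\<^sup>2 / 2 + (norm w)\<^sup>2 / (2 * ki)"
    using nz ki by (auto intro: add_pos_nonneg add_nonneg_pos)
  ultimately show "0 < v \<bullet> (P *v v)"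
    by simp
qed

section \<open>Increments and Lipschitz bounds of the flow\<close>

lemma pid_flow_block_vec:
  "pid_flow f A b kp ki kd (block_vec x \<nu>) =
    block_vec (- (matrix_inv M *v
        (gradient f x + transpose A *v \<nu> + kp *\<^sub>R (transpose A *v (A *v x - b)))))
      (ki *\<^sub>R (A *v x - b))"
  by (simp add: pid_flow_def Let_def M_def)

text \<open>Taking differences removes \<open>b\<close>. The diagonal blocks of \<open>P\<close>
  undo the inverse of \<open>M\<close> and the factor \<open>ki\<close>, so the primal-dual
  couplings \<open>u \<bullet> y\<close> and \<open>w \<bullet> (A *v u)\<close> cancel, and
  \<open>contraction_form\<close> bounds the rest.\<close>

lemma pid_flow_one_sided:
  assumes cvx: "strongly_convex \<rho> f" and smooth: "L_smooth L f"
  shows "(pid_flow f A b kp ki kd z' - pid_flow f A b kp ki kd z) \<bullet> (P *v (z' - z))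
    \<le> - c * ((z' - z) \<bullet> (P *v (z' - z)))"
proof -
  define x \<nu> x' \<nu>' where "x = vec_Inl z" "\<nu> = vec_Inr z" "x' = vec_Inl z'" "\<nu>' = vec_Inr z'"
  then have z: "z = block_vec x \<nu>" "z' = block_vec x' \<nu>'"
    by simp_all
  define u w where "u = x' - x" and "w = \<nu>' - \<nu>"
  define g where "g = gradient f x' - gradient f x"
  define r where "r = g + kp *\<^sub>R (transpose A *v (A *v u))"
  define y where "y = transpose A *v w"
  define p where "p = matrix_inv M *v y"
  have Mp: "M *v p = y"
    by (simp add: p_def M_mult_inv)
  have diff: "\<And>x. f differentiable (at x)"
    using smooth by (auto simp: L_smooth_def)
  have form: "c * (u \<bullet> (M *v u) + 2 * \<alpha> * (u \<bullet> y) + (norm w)\<^sup>2 / ki) + \<alpha> * ki * (norm (A *v u))\<^sup>2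
      \<le> u \<bullet> r + \<alpha> * (p \<bullet> r) + \<alpha> * (p \<bullet> y)"
    unfolding r_def y_def
  proof (rule contraction_form)
    show "(norm g)\<^sup>2 \<le> L * (g \<bullet> u)"
      unfolding g_def u_def
      using \<rho>_pos L_pos by (intro gradient_cocoercive[OF cvx _ smooth]) auto
    show "\<rho> * (norm u)\<^sup>2 \<le> g \<bullet> u"
      unfolding g_def u_def by (rule strongly_convex_gradient_monotone[OF cvx diff])
    show "M *v p = transpose A *v w"
      using Mp by (simp add: y_def)
  qed
  define q where "q = matrix_inv M *v (r + y)"
  have Mq: "M *v q = r + y"
    by (simp add: q_def M_mult_inv)
  have "pid_flow f A b kp ki kd z' - pid_flow f A b kp ki kd z = block_vec (- q) (ki *\<^sub>R (A *v u))"
  proof -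
    have "matrix_inv M *v s - matrix_inv M *v s' = matrix_inv M *v (s - s')" for s s'
      by (simp add: matrix_vector_mult_diff_distrib)
    then show ?thesis
      unfolding z pid_flow_block_vec block_vec_diff q_def r_def g_def y_def u_def w_def
      by (simp add: matrix_vector_mult_diff_distrib scaleR_diff_right algebra_simps
          del: transpose_matrix_vector)
  qed
  moreover have zz: "z' - z = block_vec u w"
    by (simp add: z block_vec_diff u_def w_def)
  ultimately have "(pid_flow f A b kp ki kd z' - pid_flow f A b kp ki kd z) \<bullet> (P *v (z' - z)) =
      - (q \<bullet> (M *v u)) - \<alpha> * (q \<bullet> y) + \<alpha> * ki * (norm (A *v u))\<^sup>2 + w \<bullet> (A *v u)"
    using ki by (simp add: P_mult inner_block_vec inner_add_right y_def power2_norm_eq_inner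
        inner_commute algebra_simps del: transpose_matrix_vector)
  also have "q \<bullet> (M *v u) = u \<bullet> r + u \<bullet> y"
    using inner_M[of q u] by (simp add: Mq inner_add_right inner_commute)
  \<comment> \<open>Symmetry of \<open>M\<close> moves the inverse from \<open>r + y\<close> onto
    \<open>y\<close>, which turns \<open>q\<close> into the vector \<open>p\<close> of
    \<open>contraction_form\<close>.\<close>
  also have "q \<bullet> y = p \<bullet> r + p \<bullet> y"
    using inner_M[of q p] by (simp add: Mq Mp inner_add_right inner_commute)
  also have "w \<bullet> (A *v u) = u \<bullet> y"
    using inner_transpose_mult[of A w u] by (simp add: y_def inner_commute del: transpose_matrix_vector)
  finally show ?thesis
    using form unfolding zz P_form y_def[symmetric] by (simp add: algebra_simps)
qed

lemma pid_flow_lipschitz: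
  assumes "L_smooth L f"
  shows "\<exists>C. C-lipschitz_on UNIV (pid_flow f A b kp ki kd)"
proof -
  have T: "\<exists>C. C-lipschitz_on UNIV (\<lambda>x. B *v x)" for B :: "real ^ 'i::finite ^ 'j::finite"
    by (intro linear_lipschitz matrix_vector_mul_linear)
  have S: "\<exists>C. C-lipschitz_on UNIV (\<lambda>x::real ^ 'i::finite. k *\<^sub>R x)" for k
    by (intro linear_lipschitz linear_scaleR)
  have const: "\<exists>C. C-lipschitz_on UNIV (\<lambda>x::'i::metric_space. v)" for v :: "real ^ 'j::finite"
    by (auto intro: lipschitz_on_constant)
  have neg: "\<exists>C. C-lipschitz_on UNIV (\<lambda>x::real ^ 'i::finite. - x)"
    by (intro linear_lipschitz linear_uminus)
  have grad: "\<exists>C. C-lipschitz_on UNIV (gradient f)"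
    using assms by (auto simp: L_smooth_def)
  note lip = lipschitz_ex_add lipschitz_ex_compose[OF T] lipschitz_ex_compose[OF S]
    lipschitz_ex_compose[OF neg] lipschitz_ex_compose[OF grad] const
    linear_lipschitz[OF linear_vec_Inl] linear_lipschitz[OF linear_vec_Inr]
  \<comment> \<open>Subtraction of \<open>b\<close> is written as addition of \<open>- b\<close>, so
    that the closure rule for sums matches.\<close>
  have 1: "\<exists>C. C-lipschitz_on UNIV (\<lambda>z::real ^ ('n + 'p). - (matrix_inv M *v
      (gradient f (vec_Inl z) + transpose A *v vec_Inr z
        + kp *\<^sub>R (transpose A *v (A *v vec_Inl z + - b)))))"
    by (intro lip)
  have 2: "\<exists>C. C-lipschitz_on UNIV (\<lambda>z::real ^ ('n + 'p). ki *\<^sub>R (A *v vec_Inl z + - b))"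
    by (intro lip)
  \<comment> \<open>Splitting the block vector into two linear embeddings reduces the pair to a sum
    of Lipschitz maps.\<close>
  have "pid_flow f A b kp ki kd = (\<lambda>z.
      block_vec (- (matrix_inv M *v (gradient f (vec_Inl z) + transpose A *v vec_Inr z
          + kp *\<^sub>R (transpose A *v (A *v vec_Inl z + - b))))) 0
      + block_vec 0 (ki *\<^sub>R (A *v vec_Inl z + - b)))"
    by (rule ext, subst block_vec_eq_add[symmetric])
       (simp add: pid_flow_def Let_def M_def del: transpose_matrix_vector)
  then show ?thesis
    by (simp only:)
       (intro lipschitz_ex_add lipschitz_ex_compose[OF linear_lipschitz[OF linear_block_vec_fst] 1]
          lipschitz_ex_compose[OF linear_lipschitz[OF linear_block_vec_snd] 2])
qed

end

text \<open>On a unit step from 0, the quadratic lower and upper bounds share their affine part,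
  which leaves a comparison of \<open>\<rho> / 2\<close> with \<open>L / 2\<close>.\<close>

lemma strongly_convex_L_smooth_le:
  fixes f :: "real ^ 'n::finite \<Rightarrow> real"
  assumes cvx: "strongly_convex \<rho> f" and smooth: "L_smooth L f"
  shows "\<rho> \<le> L"
proof -
  have diff: "\<And>x. f differentiable (at x)"
    using smooth by (auto simp: L_smooth_def)
  define e :: "real ^ 'n" where "e = axis undefined 1"
  have [simp]: "norm e = 1"
    by (simp add: e_def norm_axis_1)
  have "\<rho> \<le> L / 2 + \<rho> / 2"
    using strongly_convex_lower_bound[OF cvx diff, of 0 e] L_smooth_upper_bound[OF smooth, of 0 e]
    by simp
  then show ?thesis
    by simp
qed

theorem theorem4p1:
  fixes f :: "real ^ 'n::finite \<Rightarrow> real"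
    and A :: "real ^ 'n ^ 'p::finite"
    and b :: "real ^ 'p"
    and \<rho> L a_min a_max kp ki kd \<alpha> c :: real
    and M :: "real ^ 'n ^ 'n"
    and P :: "real ^ ('n + 'p) ^ ('n + 'p)"
  assumes "0 < \<rho>" and "0 < L"
    and "strongly_convex \<rho> f" and "L_smooth L f"
    and "0 < a_min" and "0 < a_max"
    and "a_min *\<^sub>R mat 1 \<preceq>\<^sub>L A ** transpose A"
    and "A ** transpose A \<preceq>\<^sub>L a_max *\<^sub>R mat 1"
    and "0 \<le> kp" and "0 < ki" and "0 \<le> kd"
    and M: "M = mat 1 + kd *\<^sub>R (transpose A ** A)"
    and \<alpha>: "\<alpha> = 1 / 2 * min (1 / (L + kp * a_max)) (\<rho> / (ki * a_max))"
    and c: "c = 1 / 2 * \<alpha> * ki * (a_min / (1 + kd * a_max))"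
    and P: "P = block_mat M (\<alpha> *\<^sub>R transpose A) (\<alpha> *\<^sub>R A) ((1 / ki) *\<^sub>R mat 1)"
  shows "pos_def_matrix P \<and> 0 < c \<and>
         strongly_inf_contracting P c (pid_flow f A b kp ki kd)"
proof -
  have \<rho>L: "\<rho> \<le> L"
    by (rule strongly_convex_L_smooth_le) fact+
  interpret primal_dual_gains A \<rho> L a_min a_max kp ki kd \<alpha> c M
  proof
    show "a_min * (norm w)\<^sup>2 \<le> (norm (transpose A *v w))\<^sup>2" for w
      by (rule loewner_bounds_transpose) fact
    show "(norm (transpose A *v w))\<^sup>2 \<le> a_max * (norm w)\<^sup>2" for w
      by (rule loewner_bounds_transpose) fact
  qed (fact assms \<rho>L)+
  obtain C where C: "C-lipschitz_on UNIV (pid_flow f A b kp ki kd)"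
    using pid_flow_lipschitz[OF \<open>L_smooth L f\<close>] by blast
  have "local_lipschitz (UNIV :: real set) UNIV (\<lambda>_. pid_flow f A b kp ki kd)"
    by (rule local_lipschitzI) (meson C lipschitz_on_subset subset_UNIV zero_less_one)
  moreover have "log_norm P (jacobian (pid_flow f A b kp ki kd) (at z)) \<le> - c"
    if "pid_flow f A b kp ki kd differentiable (at z)" for z
    unfolding P
    using log_norm_jacobian_le[OF pos_def_P pid_flow_one_sided that] assms by blast
  ultimately show ?thesis
    using pos_def_P c_pos unfolding strongly_inf_contracting_def P by blast
qed

end
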